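(* Let $I$ be an arbitrary index set and, for each $\alpha\in I$, let $X_\alpha$ be a random variable with $X_\alpha\ge 0$ and $0<\mathbb{E}X_\alpha<\infty$, and let $Y_\alpha$ be a random variable having the size biased distribution of $X_\alpha$, i.e. $Y_\alpha =^d X_\alpha^*$. (i) If $\{Y_\alpha:\alpha\in I\}$ is tight, then $\{X_\alpha:\alpha\in I\}$ is uniformly integrable. (ii) Assume further that there is a constant $c>0$ with $c\le \mathbb{E}X_\alpha$ for all $\alpha\in I$. Then $\{X_\alpha:\alpha\in I\}$ is uniformly integrable if and only if $\{Y_\alpha:\alpha\in I\}$ is tight.
   Context: For a nonnegative random variable $X$ with $a:=\mathbb{E}X\in(0,\infty)$, $X^*$ denotes a random variable with the size biased distribution of $X$: the law of $X^*$ is absolutely continuous with respect to the law of $X$ with Radon-Nikodym derivative $x/a$; equivalently $\mathbb{E}g(X^* )=\frac1a\mathbb{E}(Xg(X))$ for all bounded measurable $g$. A family of nonnegative random variables $\{Y_\alpha\}$ is tight iff for all $\varepsilon>0$ there is $L<\infty$ with $\mathbb{P}(Y_\alpha>L)<\varepsilon$ for all $\alpha$. A family of nonnegative random variables $\{X_\alpha\}$ is uniformly integrable iff for all $\delta>0$ there is $L<\infty$ with $\mathbb{E}(X_\alpha\mathbf{1}(X_\alpha>L))<\delta$ for all $\alpha$. $=^d$ denotes equality in distribution. *)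

theory Defs
  imports "HOL-Probability.Probability"
begin

text \<open>
  The density \<open>x / E X\<close> is meant for a random variable \<open>X\<close> that is almost surely nonnegative and
  has a finite, positive mean; the coercion \<open>ennreal\<close>, which sends negative reals to 0, then only
  alters the density on a null set of the law of \<open>X\<close>.
\<close>

definition size_biased_law :: "'a measure \<Rightarrow> ('a \<Rightarrow> real) \<Rightarrow> real measure" where
  "size_biased_law M X =
     density (distr M borel X) (\<lambda>x. ennreal (x / (\<integral>\<omega>. X \<omega> \<partial>M)))"

text \<open>
  In the following two notions the family is indexed by a set \<open>I\<close>, each member lives on its own
  probability space, and all members are understood to be nonnegative.  This is why only the upper
  tail appears.  The library constant \<open>tight\<close> is restricted to sequences of laws.
\<close>

definition tight_family ::
    "'i set \<Rightarrow> ('i \<Rightarrow> 'a measure) \<Rightarrow> ('i \<Rightarrow> 'a \<Rightarrow> real) \<Rightarrow> bool" where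
  "tight_family I N Y \<longleftrightarrow>
     (\<forall>\<epsilon>>0. \<exists>L. \<forall>\<alpha>\<in>I. measure (N \<alpha>) {\<omega> \<in> space (N \<alpha>). Y \<alpha> \<omega> > L} < \<epsilon>)"

text \<open>
  The tail expectation is a nonnegative integral, so that a divergent one counts as infinite
  and not, as with the Bochner integral, as 0.
\<close>

definition uniformly_integrable_family ::
    "'i set \<Rightarrow> ('i \<Rightarrow> 'a measure) \<Rightarrow> ('i \<Rightarrow> 'a \<Rightarrow> real) \<Rightarrow> bool" where
  "uniformly_integrable_family I M X \<longleftrightarrow>
     (\<forall>\<delta>::real. \<delta> > 0 \<longrightarrow> (\<exists>L. \<forall>\<alpha>\<in>I.
        (\<integral>\<^sup>+\<omega>. ennreal (X \<alpha> \<omega>) * indicator {\<omega>. X \<alpha> \<omega> > L} \<omega> \<partial>M \<alpha>) < ennreal \<delta>))"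

end

theory Submission
  imports Defs
begin

text \<open>
  Write \<open>a\<close> for the mean of \<open>X\<close>.  Taking \<open>g = 1(x > L)\<close> in the size bias identity gives
  \<open>E (X 1(X > L)) = a P(Y > L)\<close> (\<open>tail_expectation_eq\<close>): the quantity that uniform integrability
  controls and the one that tightness controls differ by the factor \<open>a\<close>.

  Passing from uniform integrability to tightness divides by \<open>a\<close>, which is harmless once the means
  are bounded away from 0.  Passing from tightness to uniform integrability multiplies by \<open>a\<close>, so the
  means have to be bounded above; tightness supplies this bound by itself.  Splitting \<open>E X\<close> at level
  \<open>L\<close> gives \<open>a \<le> L + a P(Y > L)\<close> (\<open>mean_le_level_plus_tail\<close>), and an \<open>L \<ge> 0\<close> for which
  \<open>P(Y > L) < 1/2\<close> holds throughout the family yields \<open>a \<le> 2 L\<close>.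
\<close>

text \<open>
  Multiplying the density \<open>x / a\<close> by \<open>a\<close> recovers \<open>x\<close>, so both sides are the integral of the
  positive part of \<open>x\<close> over \<open>{L<..}\<close> under the law of \<open>X\<close>.
\<close>

lemma tail_expectation_eq:
  fixes X :: "'a \<Rightarrow> real" and Y :: "'b \<Rightarrow> real"
  assumes "prob_space N" and X [measurable]: "X \<in> borel_measurable M"
    and Y [measurable]: "Y \<in> borel_measurable N"
    and mean: "0 < (\<integral>\<omega>. X \<omega> \<partial>M)"
    and law: "distr N borel Y = size_biased_law M X"
  shows "(\<integral>\<^sup>+\<omega>. ennreal (X \<omega>) * indicator {\<omega>. X \<omega> > L} \<omega> \<partial>M) =
         ennreal ((\<integral>\<omega>. X \<omega> \<partial>M) * measure N {\<omega> \<in> space N. Y \<omega> > L})"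
proof -
  interpret N: prob_space N by fact
  define a where "a = (\<integral>\<omega>. X \<omega> \<partial>M)"
  have a: "0 < a" using mean by (simp add: a_def)
  have "ennreal (measure N {\<omega> \<in> space N. Y \<omega> > L}) = emeasure (distr N borel Y) {L<..}"
    by (simp add: emeasure_distr N.emeasure_eq_measure vimage_def Int_def conj_commute)
  also have "\<dots> = (\<integral>\<^sup>+x. ennreal (x / a) * indicator {L<..} x \<partial>distr M borel X)"
    by (simp add: law size_biased_law_def a_def emeasure_density)
  also have "\<dots> = (\<integral>\<^sup>+\<omega>. ennreal (X \<omega> / a) * indicator {L<..} (X \<omega>) \<partial>M)"
    by (subst nn_integral_distr) auto
  finally have "ennreal a * ennreal (measure N {\<omega> \<in> space N. Y \<omega> > L}) =
      (\<integral>\<^sup>+\<omega>. ennreal a * (ennreal (X \<omega> / a) * indicator {L<..} (X \<omega>)) \<partial>M)"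
    by (simp add: nn_integral_cmult)
  also have "\<dots> = (\<integral>\<^sup>+\<omega>. ennreal (X \<omega>) * indicator {\<omega>. X \<omega> > L} \<omega> \<partial>M)"
    using a by (intro nn_integral_cong)
      (simp add: ennreal_mult'[symmetric] indicator_def)
  finally show ?thesis
    using a by (simp add: a_def ennreal_mult')
qed

text \<open>
  As \<open>M\<close> has total mass 1, the values of \<open>X\<close> up to \<open>L\<close> contribute at most \<open>L\<close> to the mean.
\<close>

lemma mean_le_level_plus_tail:
  fixes X :: "'a \<Rightarrow> real" and Y :: "'b \<Rightarrow> real"
  assumes "prob_space M" and "prob_space N"
    and int: "integrable M X" and nonneg: "AE \<omega> in M. X \<omega> \<ge> 0"
    and Y: "Y \<in> borel_measurable N"
    and mean: "0 < (\<integral>\<omega>. X \<omega> \<partial>M)"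
    and law: "distr N borel Y = size_biased_law M X"
    and L: "0 \<le> L"
  shows "(\<integral>\<omega>. X \<omega> \<partial>M) \<le> L + (\<integral>\<omega>. X \<omega> \<partial>M) * measure N {\<omega> \<in> space N. Y \<omega> > L}"
proof -
  interpret M: prob_space M by fact
  have X [measurable]: "X \<in> borel_measurable M"
    using int by auto
  have "ennreal (\<integral>\<omega>. X \<omega> \<partial>M) = (\<integral>\<^sup>+\<omega>. ennreal (X \<omega>) \<partial>M)"
    using int nonneg by (simp add: nn_integral_eq_integral)
  also have "\<dots> \<le> (\<integral>\<^sup>+\<omega>. ennreal L + ennreal (X \<omega>) * indicator {\<omega>. X \<omega> > L} \<omega> \<partial>M)"
    by (intro nn_integral_mono) (auto simp: indicator_def ennreal_leI)
  also have "\<dots> = ennreal L + (\<integral>\<^sup>+\<omega>. ennreal (X \<omega>) * indicator {\<omega>. X \<omega> > L} \<omega> \<partial>M)"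
    by (subst nn_integral_add) (auto simp: M.emeasure_space_1)
  also have "\<dots> = ennreal (L + (\<integral>\<omega>. X \<omega> \<partial>M) * measure N {\<omega> \<in> space N. Y \<omega> > L})"
    using mean L tail_expectation_eq[OF \<open>prob_space N\<close> X Y mean law, of L]
    by (simp add: ennreal_plus)
  finally show ?thesis
    using mean L by (subst (asm) ennreal_le_iff) auto
qed

theorem theorem8p1:
  fixes I :: "'i set"
    and M :: "'i \<Rightarrow> 'a measure" and X :: "'i \<Rightarrow> 'a \<Rightarrow> real"
    and N :: "'i \<Rightarrow> 'b measure" and Y :: "'i \<Rightarrow> 'b \<Rightarrow> real"
  assumes "\<And>\<alpha>. \<alpha> \<in> I \<Longrightarrow> prob_space (M \<alpha>)"
    and "\<And>\<alpha>. \<alpha> \<in> I \<Longrightarrow> X \<alpha> \<in> borel_measurable (M \<alpha>)"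
    and "\<And>\<alpha>. \<alpha> \<in> I \<Longrightarrow> AE \<omega> in M \<alpha>. X \<alpha> \<omega> \<ge> 0"
    and "\<And>\<alpha>. \<alpha> \<in> I \<Longrightarrow> integrable (M \<alpha>) (X \<alpha>)"
    and "\<And>\<alpha>. \<alpha> \<in> I \<Longrightarrow> 0 < (\<integral>\<omega>. X \<alpha> \<omega> \<partial>M \<alpha>)"
    and "\<And>\<alpha>. \<alpha> \<in> I \<Longrightarrow> prob_space (N \<alpha>)"
    and "\<And>\<alpha>. \<alpha> \<in> I \<Longrightarrow> Y \<alpha> \<in> borel_measurable (N \<alpha>)"
    and "\<And>\<alpha>. \<alpha> \<in> I \<Longrightarrow> distr (N \<alpha>) borel (Y \<alpha>) = size_biased_law (M \<alpha>) (X \<alpha>)"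
  shows "(tight_family I N Y \<longrightarrow> uniformly_integrable_family I M X) \<and>
         (\<forall>c::real. c > 0 \<and> (\<forall>\<alpha>\<in>I. c \<le> (\<integral>\<omega>. X \<alpha> \<omega> \<partial>M \<alpha>)) \<longrightarrow>
            (uniformly_integrable_family I M X \<longleftrightarrow> tight_family I N Y))"
proof -
  define a where "a \<alpha> = (\<integral>\<omega>. X \<alpha> \<omega> \<partial>M \<alpha>)" for \<alpha>
  define p where "p \<alpha> L = measure (N \<alpha>) {\<omega> \<in> space (N \<alpha>). Y \<alpha> \<omega> > L}" for \<alpha> L
  have a_pos: "0 < a \<alpha>" if "\<alpha> \<in> I" for \<alpha>
    using assms(5)[OF that] by (simp add: a_def)
  have tail: "(\<integral>\<^sup>+\<omega>. ennreal (X \<alpha> \<omega>) * indicator {\<omega>. X \<alpha> \<omega> > L} \<omega> \<partial>M \<alpha>) = ennreal (a \<alpha> * p \<alpha> L)"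
    if "\<alpha> \<in> I" for \<alpha> L
    unfolding a_def p_def
    using assms(6,2,7,5,8)[OF that] by (rule tail_expectation_eq)
  have mean_le: "a \<alpha> \<le> L + a \<alpha> * p \<alpha> L" if "\<alpha> \<in> I" "0 \<le> L" for \<alpha> L
    unfolding a_def p_def
    using assms(1,6,4,3,7,5,8)[OF that(1)] that(2) by (rule mean_le_level_plus_tail)
  have p_nonneg: "0 \<le> p \<alpha> L" for \<alpha> L
    by (simp add: p_def)
  have p_anti: "p \<alpha> L' \<le> p \<alpha> L" if "\<alpha> \<in> I" "L \<le> L'" for \<alpha> L L'
  proof -
    interpret prob_space "N \<alpha>" using assms(6)[OF that(1)] .
    have [measurable]: "Y \<alpha> \<in> borel_measurable (N \<alpha>)" using assms(7)[OF that(1)] .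
    show ?thesis
      unfolding p_def using that(2) by (intro finite_measure_mono) auto
  qed
  have tight_iff: "tight_family I N Y \<longleftrightarrow> (\<forall>\<epsilon>>0. \<exists>L. \<forall>\<alpha>\<in>I. p \<alpha> L < \<epsilon>)"
    by (simp add: tight_family_def p_def)
  have ui_iff: "uniformly_integrable_family I M X \<longleftrightarrow>
      (\<forall>\<delta>>0. \<exists>L. \<forall>\<alpha>\<in>I. a \<alpha> * p \<alpha> L < \<delta>)"
    using a_pos p_nonneg
    by (auto simp: uniformly_integrable_family_def tail ennreal_less_iff less_imp_le)
  have tight_imp_ui: "uniformly_integrable_family I M X" if "tight_family I N Y"
    unfolding ui_iff
  proof (intro allI impI)
    fix \<delta> :: real
    assume "\<delta> > 0"
    obtain L where L: "\<And>\<alpha>. \<alpha> \<in> I \<Longrightarrow> p \<alpha> L < 1 / 2"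
      using \<open>tight_family I N Y\<close> unfolding tight_iff by (meson half_gt_zero zero_less_one)
    \<comment> \<open>The level given by tightness may be negative, hence the maximum with a positive number.\<close>
    define B where "B = max 1 (2 * L)"
    have B: "a \<alpha> \<le> B" if "\<alpha> \<in> I" for \<alpha>
    proof -
      have "p \<alpha> (max 0 L) \<le> 1 / 2"
        using L[OF that] p_anti[OF that, of L "max 0 L"] by simp
      then have "a \<alpha> * p \<alpha> (max 0 L) \<le> a \<alpha> * (1 / 2)"
        using a_pos[OF that] by (intro mult_left_mono) auto
      then show ?thesis
        using mean_le[OF that, of "max 0 L"] by (simp add: B_def max_def split: if_splits)
    qed
    have "B > 0" by (simp add: B_def)
    then obtain K where K: "\<And>\<alpha>. \<alpha> \<in> I \<Longrightarrow> p \<alpha> K < \<delta> / B"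
      using \<open>tight_family I N Y\<close> \<open>\<delta> > 0\<close> unfolding tight_iff by (meson divide_pos_pos)
    have "a \<alpha> * p \<alpha> K < \<delta>" if "\<alpha> \<in> I" for \<alpha>
    proof -
      have "a \<alpha> * p \<alpha> K \<le> B * p \<alpha> K"
        using B[OF that] p_nonneg by (rule mult_right_mono)
      also have "\<dots> < \<delta>"
        using K[OF that] \<open>B > 0\<close> by (simp add: field_simps)
      finally show ?thesis .
    qed
    then show "\<exists>L. \<forall>\<alpha>\<in>I. a \<alpha> * p \<alpha> L < \<delta>" by blast
  qed
  have ui_imp_tight: "tight_family I N Y"
    if ui: "uniformly_integrable_family I M X" and "c > 0" and c: "\<And>\<alpha>. \<alpha> \<in> I \<Longrightarrow> c \<le> a \<alpha>" for c
    unfolding tight_iff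
  proof (intro allI impI)
    fix \<epsilon> :: real
    assume "\<epsilon> > 0"
    then obtain L where L: "\<And>\<alpha>. \<alpha> \<in> I \<Longrightarrow> a \<alpha> * p \<alpha> L < c * \<epsilon>"
      using ui \<open>c > 0\<close> unfolding ui_iff by (meson mult_pos_pos)
    have "p \<alpha> L < \<epsilon>" if "\<alpha> \<in> I" for \<alpha>
    proof -
      have "c * p \<alpha> L \<le> a \<alpha> * p \<alpha> L"
        using c[OF that] p_nonneg by (rule mult_right_mono)
      also have "\<dots> < c * \<epsilon>" using L[OF that] .
      finally show ?thesis using \<open>c > 0\<close> by simp
    qed
    then show "\<exists>L. \<forall>\<alpha>\<in>I. p \<alpha> L < \<epsilon>" by blast
  qed
  show ?thesis
    using tight_imp_ui ui_imp_tight unfolding a_def by blast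
qed

end
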